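(* Consider a layered computational graph with terminal vector feedback, backpropagated gradients $\mathbf g_v$ and parameter gradients $\mathbf g_v^\theta$ as described in the context. Assume that condition (A), condition (B), and the non-degeneracy assumption (all stated in the context) hold. Let the synthetic gradients be the oracle ones with all mixing weights equal to $0$, i.e. define recursively $\tilde{\mathbf g}_v:=\mathbf g_v$ for $v\in V_L$ and, for non-terminal $v$, $$\tilde{\mathbf g}_v:=\sum_{v^+\in \mathrm{ch}(v)}\mathbf J_v^{v^+}\,\mathbb E[\tilde{\mathbf g}_{v^+}\mid \mathbf z_{v^+}],$$ and, for non-input $v$, $\tilde{\mathbf g}_v^{\theta}:=\mathbf J_v^\theta\tilde{\mathbf g}_v$. For $n\ge1$ let $\hat{\tilde{\mathbf g}}_v^{\theta}$ and $\hat{\mathbf g}_v^{\theta}$ be the empirical means of $n$ i.i.d. samples of $\tilde{\mathbf g}_v^{\theta}$ and of $\mathbf g_v^\theta$, respectively, and put $$\tilde\Delta_v^2:=\mathbb E\bigl\|\hat{\tilde{\mathbf g}}_v^{\theta}-\mathbb E\,\mathbf g_v^{\theta}\bigr\|_2^2,\qquad \Delta_v^2:=\mathbb E\bigl\|\hat{\mathbf g}_v^{\theta}-\mathbb E\,\mathbf g_v^{\theta}\bigr\|_2^2 .$$ Then $\tilde\Delta_v^2\le\Delta_v^2$ for every non-input node $v\in V$, and there exists a node $v$ with $\tilde\Delta_v^2<\Delta_v^2$.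
   Context: Layered graph. $G=(V,E)$ is a finite layered DAG, $V=\bigcup_{l=0}^L V_l$, edges go only from a layer to the next; $\mathrm{pa}(v)\subseteq V_{l-1}$ and $\mathrm{ch}(v)\subseteq V_{l+1}$ denote the parents and children of $v\in V_l$. Nodes in $V_0$ are input nodes, nodes in $V_L$ are terminal nodes. Each node $v$ carries a random vector $\mathbf x_v\in\mathbb R^{d_v}$. Input variables $(\mathbf x_v)_{v\in V_0}$ are drawn from an external distribution, and for input nodes $\mathbf z_v:=\mathbf x_v$. For a non-input node, $\mathbf x_v=f_v(\mathbf z_v;\theta_v)$ with $f_v$ differentiable, $\theta_v$ a local (deterministic) parameter vector, and local observation $\mathbf z_v:=((\mathbf x_{v^-})_{v^-\in \mathrm{pa}(v)},\xi_v)$, where $\xi_v$ is an optional auxiliary random variable, independent of everything else, which governs the stochastic behaviour of $v$. All random variables are assumed to have finite second moments. Backpropagation. Each terminal node $v\in V_L$ is given an external random feedback vector $\mathbf g_v\in\mathbb R^{d_v}$. For a non-terminal node, $\mathbf g_v=\sum_{v^+\in \mathrm{ch}(v)}\mathbf J_v^{v^+}\mathbf g_{v^+}$, where $\mathbf J_v^{v^+}:=(\partial \mathbf x_{v^+}/\partial \mathbf x_v)^\top$ is the transposed Jacobian of the local computation at $v^+$ (a function of $\mathbf z_{v^+}$). For a non-input node, $\mathbf g_v^\theta:=\mathbf J_v^\theta \mathbf g_v$ with $\mathbf J_v^\theta:=(\partial \mathbf x_v/\partial\theta_v)^\top$ (a function of $\mathbf z_v$). Extended ancestors. For a non-input node $v\in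 V_l$, $\mathrm{sib}(v):=\{v'\in V_l:\mathrm{pa}(v')\cap \mathrm{pa}(v)\ne\varnothing\}$ (with $v$ itself included). Define recursively $\mathrm{an}_{\mathrm{sib}}(v):=\bigl(\bigcup_{v^-\in \mathrm{pa}(\mathrm{sib}(v))}\mathrm{an}_{\mathrm{sib}}(v^-)\bigr)\cup \mathrm{sib}(v)$, where $\mathrm{pa}(\mathrm{sib}(v))$ is the set of all parents of nodes in $\mathrm{sib}(v)$ and $\mathrm{an}_{\mathrm{sib}}(v):=\varnothing$ for input nodes. For $U\subseteq V$, $\mathbf Z_U:=\{\mathbf z_u:u\in U\}$. Condition (A): at least one of the following holds. (A.1) For some terminal node $u\in V_L$, the feedback $\mathbf g_u$ is not almost surely a deterministic function of $\mathbf x_u$. (A.2) Some node performs stochastic computation (through its auxiliary variable $\xi_u$). (A.3) Some non-input node $u\in V_l$ has $\mathrm{pa}(u)\neq V_{l-1}$. Condition (B): for every non-input node $v$ and every subset $U\subseteq \mathrm{an}_{\mathrm{sib}}(v)$, $\mathbb E[\mathbf g_v\mid \mathbf z_v]=\mathbb E[\mathbf g_v\mid \mathbf z_v,\mathbf Z_U]$ almost surely. Non-degeneracy assumption: there exist a non-terminal node $v$ (having a parameter gradient, hence non-input) and a source random variable $\boldsymbol\chi$ corresponding to one of (A.1)–(A.3), such that with positive probability $$\mathbb E[\mathbf g_v^\theta\mid \mathbf z_v,\mathbf Z_{\mathrm{ch}(v)}]\neq \mathbb E[\mathbf g_v^\theta\mid \mathbf z_v,\mathbf Z_{\mathrm{ch}(v)},\boldsymbol\chi].$$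 Here a source variable is: under (A.1) an exogenous source of terminal feedback randomness; under (A.2) an internal source of stochastic computation; under (A.3) a collection of node variables unobserved by $v$ due to sparse connectivity. *)

theory Defs
  imports "HOL-Probability.Probability"
begin

section \<open>Computational graphs\<close>

text \<open>
  Nodes are the elements of a finite type \<open>'v\<close>.  Node dimensions vary from node to node: all node
  vectors live in the common type \<open>real ^ 'n\<close>, and the space \<open>R^(d_v)\<close> of node \<open>v\<close> is the
  coordinate subspace of the vectors vanishing outside the index set \<open>dims N v\<close>, which has
  \<open>d_v\<close> elements.  Local parameter vectors are treated in the same way, with \<open>real ^ 'p\<close> and
  \<open>pdims N v\<close>.  A tuple of node vectors is an element of \<open>real ^ 'n ^ 'v\<close>, with zero blocks
  at the nodes which do not belong to the tuple.

  The auxiliary variable \<open>aux N v\<close> takes values in an arbitrary measurable space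
  \<open>aux_space N v\<close>; a node without auxiliary variable is a node with a constant one.
  The value of \<open>feedback N v\<close> is relevant at terminal nodes only, that of \<open>local_map N v\<close> and
  \<open>param N v\<close> at non-input nodes only.
\<close>

record ('v, 'n, 'p, 'e, 'w) net =
  omega :: "'w measure"
  layer :: "'v \<Rightarrow> nat"
  depth :: nat
  edge :: "'v \<Rightarrow> 'v \<Rightarrow> bool"
  dims :: "'v \<Rightarrow> 'n set"
  pdims :: "'v \<Rightarrow> 'p set"
  local_map :: "'v \<Rightarrow> (real ^ 'n ^ 'v) \<times> 'e \<Rightarrow> real ^ 'p \<Rightarrow> real ^ 'n"
  param :: "'v \<Rightarrow> real ^ 'p"
  aux_space :: "'v \<Rightarrow> 'e measure"
  aux :: "'v \<Rightarrow> 'w \<Rightarrow> 'e"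
  val :: "'v \<Rightarrow> 'w \<Rightarrow> real ^ 'n"
  feedback :: "'v \<Rightarrow> 'w \<Rightarrow> real ^ 'n"

definition input_node :: "('v::finite, 'n::finite, 'p::finite, 'e, 'w) net \<Rightarrow> 'v \<Rightarrow> bool" where
  "input_node N v \<longleftrightarrow> layer N v = 0"

definition terminal_node :: "('v::finite, 'n::finite, 'p::finite, 'e, 'w) net \<Rightarrow> 'v \<Rightarrow> bool" where
  "terminal_node N v \<longleftrightarrow> layer N v = depth N"

definition pa :: "('v::finite, 'n::finite, 'p::finite, 'e, 'w) net \<Rightarrow> 'v \<Rightarrow> 'v set" where
  "pa N v = {u. edge N u v}"

definition ch :: "('v::finite, 'n::finite, 'p::finite, 'e, 'w) net \<Rightarrow> 'v \<Rightarrow> 'v set" where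
  "ch N v = {w. edge N v w}"

definition supported_on :: "'k set \<Rightarrow> real ^ 'k \<Rightarrow> bool" where
  "supported_on D a \<longleftrightarrow> (\<forall>i. i \<notin> D \<longrightarrow> a $ i = 0)"

definition project :: "'k set \<Rightarrow> real ^ 'k \<Rightarrow> real ^ 'k" where
  "project D a = (\<chi> i. if i \<in> D then a $ i else 0)"

definition vals :: "('v::finite, 'n::finite, 'p::finite, 'e, 'w) net \<Rightarrow> 'v set \<Rightarrow> 'w \<Rightarrow> real ^ 'n ^ 'v" where
  "vals N W \<omega> = (\<chi> u. if u \<in> W then val N u \<omega> else 0)"

text \<open>
  The local observation.  At an input node the auxiliary variable is required to be constant below,
  so that \<open>obs N v\<close> is the node's own value there.
\<close>

definition obs :: "('v::finite, 'n::finite, 'p::finite, 'e, 'w) net \<Rightarrow> 'v \<Rightarrow> 'w \<Rightarrow> (real ^ 'n ^ 'v) \<times> 'e" where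
  "obs N v \<omega> = (vals N (if input_node N v then {v} else pa N v) \<omega>, aux N v \<omega>)"

definition obs_space :: "('v::finite, 'n::finite, 'p::finite, 'e, 'w) net \<Rightarrow> 'v \<Rightarrow> ((real ^ 'n ^ 'v) \<times> 'e) measure" where
  "obs_space N v = borel \<Otimes>\<^sub>M aux_space N v"


section \<open>Sigma-algebras and conditional expectations\<close>

definition sigma_vals :: "('v::finite, 'n::finite, 'p::finite, 'e, 'w) net \<Rightarrow> 'v set \<Rightarrow> 'w measure" where
  "sigma_vals N W = vimage_algebra (space (omega N)) (vals N W) borel"

definition sigma_aux :: "('v::finite, 'n::finite, 'p::finite, 'e, 'w) net \<Rightarrow> 'v \<Rightarrow> 'w measure" where
  "sigma_aux N v = vimage_algebra (space (omega N)) (aux N v) (aux_space N v)"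

definition sigma_obs :: "('v::finite, 'n::finite, 'p::finite, 'e, 'w) net \<Rightarrow> 'v set \<Rightarrow> 'w measure" where
  "sigma_obs N U =
     vimage_algebra (space (omega N)) (\<lambda>\<omega>. \<lambda>u\<in>U. obs N u \<omega>) (PiM U (obs_space N))"

definition sigma_join :: "'w measure \<Rightarrow> 'w measure \<Rightarrow> 'w measure" where
  "sigma_join F G = sigma (space F) (sets F \<union> sets G)"

text \<open>Conditional expectation of a random vector, taken componentwise.\<close>

definition vec_cond_exp :: "'w measure \<Rightarrow> 'w measure \<Rightarrow> ('w \<Rightarrow> real ^ 'k::finite) \<Rightarrow> 'w \<Rightarrow> real ^ 'k" where
  "vec_cond_exp M F Y \<omega> = (\<chi> i. real_cond_exp M F (\<lambda>\<omega>'. Y \<omega>' $ i) \<omega>)"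

text \<open>
  The auxiliary variables are mutually independent, and jointly independent of the sigma-algebra
  \<open>F\<close>, which plays the role of the remaining (external) randomness.
\<close>

definition aux_independent_of :: "('v::finite, 'n::finite, 'p::finite, 'e, 'w) net \<Rightarrow> 'w measure \<Rightarrow> bool" where
  "aux_independent_of N F \<longleftrightarrow>
     prob_space.indep_sets (omega N)
       (\<lambda>k. case k of None \<Rightarrow> sets F | Some v \<Rightarrow> sets (sigma_aux N v)) UNIV"


section \<open>Layered networks\<close>

text \<open>
  In \<open>local_map_project\<close>, the map at \<open>v\<close> is defined on the whole ambient type but depends only on
  the coordinates of its parents and of its own parameter; hence differentiability on the ambient
  space is differentiability in these coordinates, and all partial derivatives in the padding
  coordinates vanish.
\<close>

locale layered_net =
  fixes N :: "('v::finite, 'n::finite, 'p::finite, 'e, 'w) net"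
  assumes prob: "prob_space (omega N)"
    and layer_le: "layer N v \<le> depth N"
    and edge_layer: "edge N u v \<Longrightarrow> layer N v = Suc (layer N u)"
    and val_supported: "\<omega> \<in> space (omega N) \<Longrightarrow> supported_on (dims N v) (val N v \<omega>)"
    and input_measurable: "input_node N v \<Longrightarrow> val N v \<in> borel_measurable (omega N)"
    and input_aux: "input_node N v \<Longrightarrow> \<exists>c. \<forall>\<omega>\<in>space (omega N). aux N v \<omega> = c"
    and aux_measurable: "aux N v \<in> measurable (omega N) (aux_space N v)"
    and aux_indep: "aux_independent_of N (sigma_vals N {u. input_node N u})"
    and val_eq: "\<not> input_node N v \<Longrightarrow> \<omega> \<in> space (omega N) \<Longrightarrow>
      val N v \<omega> = local_map N v (obs N v \<omega>) (param N v)"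
    and param_supported: "supported_on (pdims N v) (param N v)"
    and local_map_supported: "\<not> input_node N v \<Longrightarrow> e \<in> space (aux_space N v) \<Longrightarrow>
      supported_on (dims N v) (local_map N v (y, e) t)"
    and local_map_project: "\<not> input_node N v \<Longrightarrow> e \<in> space (aux_space N v) \<Longrightarrow>
      local_map N v (y, e) t =
      local_map N v ((\<chi> u. if u \<in> pa N v then project (dims N u) (y $ u) else 0), e)
        (project (pdims N v) t)"
    and local_map_measurable: "\<not> input_node N v \<Longrightarrow>
      (\<lambda>zz. local_map N v zz t) \<in> borel_measurable (obs_space N v)"
    and local_map_differentiable: "\<not> input_node N v \<Longrightarrow> e \<in> space (aux_space N v) \<Longrightarrow>
      (\<lambda>(y, t). local_map N v (y, e) t) differentiable_on UNIV"
    and feedback_measurable: "terminal_node N v \<Longrightarrow> feedback N v \<in> borel_measurable (omega N)"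
    and feedback_supported: "terminal_node N v \<Longrightarrow> \<omega> \<in> space (omega N) \<Longrightarrow>
      supported_on (dims N v) (feedback N v \<omega>)"
begin

text \<open>
  Transposed Jacobians of the local computation: \<open>jac v w zz\<close> differentiates the value of the child
  \<open>w\<close> with respect to that of \<open>v\<close> at the observation \<open>zz\<close> of \<open>w\<close>.
\<close>

definition jac :: "'v \<Rightarrow> 'v \<Rightarrow> (real ^ 'n ^ 'v) \<times> 'e \<Rightarrow> real ^ 'n ^ 'n" where
  "jac v w zz = transpose (jacobian
     (\<lambda>a. local_map N w ((\<chi> u. if u = v then a else fst zz $ u), snd zz) (param N w))
     (at (fst zz $ v)))"

definition jac_param :: "'v \<Rightarrow> (real ^ 'n ^ 'v) \<times> 'e \<Rightarrow> real ^ 'n ^ 'p" where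
  "jac_param v zz = transpose (jacobian (\<lambda>t. local_map N v zz t) (at (param N v)))"

function grad :: "'v \<Rightarrow> 'w \<Rightarrow> real ^ 'n" where
  "grad v = (if terminal_node N v then feedback N v
     else (\<lambda>\<omega>. \<Sum>w\<in>ch N v. jac v w (obs N w \<omega>) *v grad w \<omega>))"
  by auto
termination
proof (relation "Wellfounded.measure (\<lambda>v. depth N - layer N v)", goal_cases)
  case 1
  show ?case by simp
next
  case (2 v \<omega> w)
  then have "layer N w = Suc (layer N v)" "layer N w \<le> depth N"
    using edge_layer[of v w] layer_le[of w] by (simp_all add: ch_def)
  then show ?case by simp
qed

definition grad_param :: "'v \<Rightarrow> 'w \<Rightarrow> real ^ 'p" where
  "grad_param v \<omega> = jac_param v (obs N v \<omega>) *v grad v \<omega>"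

text \<open>Oracle synthetic gradients with all mixing weights equal to zero.\<close>

function syn_grad :: "'v \<Rightarrow> 'w \<Rightarrow> real ^ 'n" where
  "syn_grad v = (if terminal_node N v then grad v
     else (\<lambda>\<omega>. \<Sum>w\<in>ch N v.
       jac v w (obs N w \<omega>) *v vec_cond_exp (omega N) (sigma_obs N {w}) (syn_grad w) \<omega>))"
  by auto
termination
proof (relation "Wellfounded.measure (\<lambda>v. depth N - layer N v)", goal_cases)
  case 1
  show ?case by simp
next
  case (2 v \<omega> w)
  then have "layer N w = Suc (layer N v)" "layer N w \<le> depth N"
    using edge_layer[of v w] layer_le[of w] by (simp_all add: ch_def)
  then show ?case by simp
qed

definition syn_grad_param :: "'v \<Rightarrow> 'w \<Rightarrow> real ^ 'p" where
  "syn_grad_param v \<omega> = jac_param v (obs N v \<omega>) *v syn_grad v \<omega>"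

declare grad.simps [simp del] syn_grad.simps [simp del]

definition finite_second_moments :: bool where
  "finite_second_moments \<longleftrightarrow>
     (\<forall>v. integrable (omega N) (\<lambda>\<omega>. (norm (val N v \<omega>))\<^sup>2)) \<and>
     (\<forall>v. integrable (omega N) (\<lambda>\<omega>. (norm (grad v \<omega>))\<^sup>2)) \<and>
     (\<forall>v. \<not> input_node N v \<longrightarrow> integrable (omega N) (\<lambda>\<omega>. (norm (grad_param v \<omega>))\<^sup>2))"


subsection \<open>Extended ancestors\<close>

definition sib :: "'v \<Rightarrow> 'v set" where
  "sib v = insert v {v'. layer N v' = layer N v \<and> pa N v' \<inter> pa N v \<noteq> {}}"

function an_sib :: "'v \<Rightarrow> 'v set" where
  "an_sib v = (if input_node N v then {}
     else (\<Union>u\<in>(\<Union>v'\<in>sib v. pa N v'). an_sib u) \<union> sib v)"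
  by auto
termination
proof (relation "Wellfounded.measure (layer N)", goal_cases)
  case 1
  show ?case by simp
next
  case (2 v u)
  then obtain v' where "v' \<in> sib v" "u \<in> pa N v'"
    by blast
  then have "layer N v' = layer N v" "layer N v' = Suc (layer N u)"
    using edge_layer by (auto simp: sib_def pa_def)
  then show ?case by simp
qed

declare an_sib.simps [simp del]


subsection \<open>Conditions\<close>

definition feedback_nondet :: "'v \<Rightarrow> bool" where
  "feedback_nondet u \<longleftrightarrow> terminal_node N u \<and>
     \<not> (\<exists>h\<in>borel_measurable borel. AE \<omega> in omega N. feedback N u \<omega> = h (val N u \<omega>))"

definition stochastic_node :: "'v \<Rightarrow> bool" where
  "stochastic_node u \<longleftrightarrow> \<not> input_node N u \<and>
     \<not> (\<exists>h\<in>borel_measurable borel. AE \<omega> in omega N. val N u \<omega> = h (vals N (pa N u) \<omega>))"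

definition sparse_node :: "'v \<Rightarrow> bool" where
  "sparse_node u \<longleftrightarrow> \<not> input_node N u \<and> pa N u \<noteq> {w. Suc (layer N w) = layer N u}"

definition condition_A :: bool where
  "condition_A \<longleftrightarrow>
     (\<exists>u. feedback_nondet u) \<or> (\<exists>u. stochastic_node u) \<or> (\<exists>u. sparse_node u)"

definition condition_B :: bool where
  "condition_B \<longleftrightarrow> (\<forall>v. \<not> input_node N v \<longrightarrow> (\<forall>U \<subseteq> an_sib v.
     AE \<omega> in omega N.
       vec_cond_exp (omega N) (sigma_obs N {v}) (grad v) \<omega> =
       vec_cond_exp (omega N) (sigma_obs N (insert v U)) (grad v) \<omega>))"

text \<open>
  Source variables enter through conditioning only, so they are represented by the sigma-algebra
  they generate; this avoids quantifying over their value spaces.  (Every sub-sigma-algebra \<open>S\<close> is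
  generated by a random variable, namely the identity map into \<open>(\<Omega>, S)\<close>; it stands for
  the source in \<open>feedback_source\<close>.)

  A source of terminal feedback randomness is exogenous, i.e. independent, jointly with the network
  inputs, of the auxiliary variables, and it accounts for the randomness of a feedback vector which
  is left when the terminal values are given.
\<close>

definition feedback_source :: "'w measure \<Rightarrow> bool" where
  "feedback_source S \<longleftrightarrow> subalgebra (omega N) S \<and>
     aux_independent_of N (sigma_join (sigma_vals N {u. input_node N u}) S) \<and>
     (\<exists>u. feedback_nondet u \<and>
       (\<exists>h\<in>borel_measurable (borel \<Otimes>\<^sub>M S).
         AE \<omega> in omega N. feedback N u \<omega> = h (vals N {w. terminal_node N w} \<omega>, \<omega>)))"

definition stochastic_source :: "'w measure \<Rightarrow> bool" where
  "stochastic_source S \<longleftrightarrow> (\<exists>u. stochastic_node u \<and> S = sigma_aux N u)"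

text \<open>
  The nodes of the preceding layer which are not parents of \<open>v\<close> are those which \<open>v\<close> would observe
  if the connectivity were full.
\<close>

definition sparsity_source :: "'v \<Rightarrow> 'w measure \<Rightarrow> bool" where
  "sparsity_source v S \<longleftrightarrow> sparse_node v \<and>
     (\<exists>W. W \<noteq> {} \<and> W \<subseteq> {w. Suc (layer N w) = layer N v} - pa N v \<and> S = sigma_vals N W)"

definition nondegenerate :: bool where
  "nondegenerate \<longleftrightarrow> (\<exists>v S. \<not> input_node N v \<and> \<not> terminal_node N v \<and>
     (feedback_source S \<or> stochastic_source S \<or> sparsity_source v S) \<and>
     measure (omega N) {\<omega> \<in> space (omega N).
       vec_cond_exp (omega N) (sigma_obs N (insert v (ch N v))) (grad_param v) \<omega> \<noteq>
       vec_cond_exp (omega N) (sigma_join (sigma_obs N (insert v (ch N v))) S) (grad_param v) \<omega>} > 0)"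

end


section \<open>Estimation error\<close>

text \<open>
  Mean squared distance from \<open>m\<close> of the empirical mean of \<open>n\<close> i.i.d. samples of \<open>Y\<close>; the samples are
  realised on the \<open>n\<close>-fold product space.  The expectation is a nonnegative integral, so that
  it is never defaulted to 0 for lack of integrability.
\<close>

definition emp_mean :: "nat \<Rightarrow> ('w \<Rightarrow> real ^ 'k) \<Rightarrow> (nat \<Rightarrow> 'w) \<Rightarrow> real ^ 'k" where
  "emp_mean n Y s = (1 / real n) *\<^sub>R (\<Sum>k<n. Y (s k))"

definition mean_sq_error :: "'w measure \<Rightarrow> nat \<Rightarrow> ('w \<Rightarrow> real ^ 'k::finite) \<Rightarrow> real ^ 'k \<Rightarrow> ennreal" where
  "mean_sq_error M n Y m =
     (\<integral>\<^sup>+ s. ennreal ((norm (emp_mean n Y s - m))\<^sup>2) \<partial>(PiM {..<n} (\<lambda>_. M)))"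

context layered_net
begin

definition err :: "nat \<Rightarrow> 'v \<Rightarrow> ennreal" where
  "err n v = mean_sq_error (omega N) n (grad_param v)
     (\<integral>\<omega>. grad_param v \<omega> \<partial>omega N)"

definition syn_err :: "nat \<Rightarrow> 'v \<Rightarrow> ennreal" where
  "syn_err n v = mean_sq_error (omega N) n (syn_grad_param v)
     (\<integral>\<omega>. grad_param v \<omega> \<partial>omega N)"

end

end

(*
  By condition (B), E[g_w | z_w] = E[g_w | Z_U] for every child w of v and U = {v} \<union> ch(v), because
  U consists of extended ancestors of w.  Induction from the terminal layer downwards, with the
  tower property, therefore identifies the synthetic parameter gradient of a non-terminal node v
  with E[g_v^theta | Z_U].  The error of an empirical mean is the variance divided by n, and
  conditioning reduces the variance by E|g_v^theta - E[g_v^theta | Z_U]|^2.  If this loss were zero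
  at the node of the non-degeneracy assumption, then g_v^theta would be a function of Z_U there,
  and no further source variable could change its conditional expectation.
*)

theory Submission
  imports Defs
begin

section \<open>Measurability and integrability of vectors through their components\<close>

lemma borel_measurable_vec_iff:
  fixes f :: "'a \<Rightarrow> 'b::euclidean_space ^ 'k::finite"
  shows "f \<in> borel_measurable M \<longleftrightarrow> (\<forall>i. (\<lambda>x. f x $ i) \<in> borel_measurable M)"
  \<comment> \<open>The basis of \<open>'b ^ 'k\<close> consists of the vectors
    \<open>axis i b\<close>, and the inner product of \<open>f x\<close> with such a vector is that
    of \<open>f x $ i\<close> with \<open>b\<close>.\<close>
  by (subst borel_measurable_euclidean_space, subst borel_measurable_euclidean_space)
    (auto simp: Basis_vec_def inner_axis)

lemma borel_measurable_matrix_vector_mult: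
  fixes X :: "'a \<Rightarrow> real ^ 'j::finite ^ 'k::finite"
  assumes "\<And>i j. (\<lambda>x. X x $ i $ j) \<in> borel_measurable F" "Y \<in> borel_measurable F"
  shows "(\<lambda>x. X x *v Y x) \<in> borel_measurable F"
  using assms unfolding borel_measurable_vec_iff matrix_vector_mult_def vec_lambda_beta
  by (intro allI borel_measurable_sum borel_measurable_times) auto

lemma integrable_vec_nth:
  fixes f :: "'a \<Rightarrow> real ^ 'k::finite"
  assumes "integrable M f"
  shows "integrable M (\<lambda>x. f x $ i)"
  using integrable_bounded_linear[OF bounded_linear_vec_nth assms] .

lemma integral_vec_nth:
  fixes f :: "'a \<Rightarrow> real ^ 'k::finite"
  assumes "integrable M f"
  shows "(\<integral>x. f x \<partial>M) $ i = (\<integral>x. f x $ i \<partial>M)"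
  using integral_bounded_linear[OF bounded_linear_vec_nth assms, of i] by simp

lemma norm_vec_power2:
  fixes a :: "real ^ 'k::finite"
  shows "(norm a)\<^sup>2 = (\<Sum>i\<in>UNIV. (a $ i)\<^sup>2)"
  unfolding power2_norm_eq_inner inner_vec_def by (simp add: power2_eq_square)

lemma integrable_norm_power2_iff:
  fixes f :: "'a \<Rightarrow> real ^ 'k::finite"
  assumes [measurable]: "f \<in> borel_measurable M"
  shows "integrable M (\<lambda>x. (norm (f x))\<^sup>2) \<longleftrightarrow> (\<forall>i. integrable M (\<lambda>x. (f x $ i)\<^sup>2))"
proof (intro iffI allI)
  fix i
  have [measurable]: "(\<lambda>x. f x $ i) \<in> borel_measurable M"
    using assms by (simp add: borel_measurable_vec_iff)
  assume "integrable M (\<lambda>x. (norm (f x))\<^sup>2)"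
  then show "integrable M (\<lambda>x. (f x $ i)\<^sup>2)"
  proof (rule Bochner_Integration.integrable_bound)
    have "(f x $ i)\<^sup>2 \<le> (norm (f x))\<^sup>2" for x
      using power_mono[OF component_le_norm_cart[of "f x" i] abs_ge_zero, of 2] by simp
    then show "AE x in M. norm ((f x $ i)\<^sup>2) \<le> norm ((norm (f x))\<^sup>2)"
      by simp
  qed measurable
qed (simp add: norm_vec_power2)

text \<open>Square integrability implies integrability because the constant 1 is integrable on a
  finite measure space and \<open>1 + (norm (f x))\<^sup>2\<close> dominates the norm.\<close>

lemma (in finite_measure) integrable_of_norm_power2:
  fixes f :: "'a \<Rightarrow> real ^ 'k::finite"
  assumes [measurable]: "f \<in> borel_measurable M" and "integrable M (\<lambda>x. (norm (f x))\<^sup>2)"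
  shows "integrable M f"
proof (rule Bochner_Integration.integrable_bound)
  show "integrable M (\<lambda>x. 1 + (norm (f x))\<^sup>2)"
    using assms(2) by simp
  \<comment> \<open>Follows from the nonnegativity of the square of \<open>a - 1/2\<close>.\<close>
  have "a \<le> 1 + a\<^sup>2" for a :: real
    using sum_power2_ge_zero[of "a - 1/2" 0] by (simp add: power2_eq_square algebra_simps)
  then show "AE x in M. norm (f x) \<le> norm (1 + (norm (f x))\<^sup>2)"
    by auto
qed measurable


text \<open>An elementary domination which makes products of two square integrable functions
  integrable.\<close>

lemma abs_mult_le_sum_squares: "\<bar>a * b\<bar> \<le> a\<^sup>2 + b\<^sup>2" for a b :: real
proof -
  have "2 * \<bar>a * b\<bar> \<le> a\<^sup>2 + b\<^sup>2"
    using sum_squares_bound[of "\<bar>a\<bar>" "\<bar>b\<bar>"] by (simp add: abs_mult)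
  then show ?thesis
    using abs_ge_zero[of "a * b"] by linarith
qed


section \<open>Conditional expectations\<close>

text \<open>
  The summands need not be integrable, so linearity applies only after truncation to the events,
  measurable in the conditioning sigma-algebra, on which all coefficients are bounded.
\<close>

lemma (in sigma_finite_subalgebra) real_cond_exp_sum_mult:
  fixes X Y :: "'i \<Rightarrow> 'a \<Rightarrow> real"
  assumes I: "finite I"
    and X: "\<And>i. i \<in> I \<Longrightarrow> X i \<in> borel_measurable F"
    and Y: "\<And>i. i \<in> I \<Longrightarrow> integrable M (Y i)"
    and S: "integrable M (\<lambda>x. \<Sum>i\<in>I. X i x * Y i x)"
  shows "AE x in M. real_cond_exp M F (\<lambda>x. \<Sum>i\<in>I. X i x * Y i x) x =
    (\<Sum>i\<in>I. X i x * real_cond_exp M F (Y i) x)"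
proof -
  let ?S = "\<lambda>x. \<Sum>i\<in>I. X i x * Y i x"
  define A where "A m x = (if \<forall>i\<in>I. \<bar>X i x\<bar> \<le> real m then 1 else 0 :: real)" for m x
  have X_M: "X i \<in> borel_measurable M" if "i \<in> I" for i
    using X[OF that] by (rule measurable_from_subalg[OF subalg])
  have A_F [measurable]: "A m \<in> borel_measurable F" for m
  proof -
    have "{x \<in> space F. \<forall>i\<in>I. \<bar>X i x\<bar> \<le> real m} \<in> sets F"
      using I X by (intro sets.sets_Collect_finite_All) (auto intro!: borel_measurable_le borel_measurable_abs)
    then show ?thesis
      unfolding A_def by (intro measurable_If) auto
  qed
  have A_M [measurable]: "A m \<in> borel_measurable M" for m
    by (rule measurable_from_subalg[OF subalg A_F])
  have "AE x in M. A m x * real_cond_exp M F ?S x =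
      A m x * (\<Sum>i\<in>I. X i x * real_cond_exp M F (Y i) x)" for m
  proof -
    \<comment> \<open>\<open>Z\<close> is extended by zero outside \<open>I\<close> because
      \<open>real_cond_exp_sum\<close> asks for integrability at every index.\<close>
    define Z where "Z i x = (if i \<in> I then A m x * X i x * Y i x else 0)" for i x
    have Z_int: "integrable M (Z i)" for i
    proof (cases "i \<in> I")
      case True
      have [measurable]: "X i \<in> borel_measurable M" "Y i \<in> borel_measurable M"
        using X_M[OF True] Y[OF True] by auto
      have "integrable M (\<lambda>x. A m x * X i x * Y i x)"
      proof (rule Bochner_Integration.integrable_bound)
        show "integrable M (\<lambda>x. real m * Y i x)"
          using Y[OF True] by simp
        show "AE x in M. norm (A m x * X i x * Y i x) \<le> norm (real m * Y i x)"
          using True by (auto simp: A_def abs_mult intro!: mult_right_mono)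
      qed measurable
      then show ?thesis
        using True by (simp add: Z_def[abs_def])
    qed (simp add: Z_def[abs_def])
    have AS_int: "integrable M (\<lambda>x. A m x * ?S x)"
    proof (rule Bochner_Integration.integrable_bound[OF S])
      show "(\<lambda>x. A m x * ?S x) \<in> borel_measurable M"
        using S by (intro borel_measurable_times A_M) auto
      show "AE x in M. norm (A m x * ?S x) \<le> norm (?S x)"
        by (simp add: A_def)
    qed
    have sum_eq: "(\<lambda>x. A m x * ?S x) = (\<lambda>x. \<Sum>i\<in>I. Z i x)"
      by (auto simp: Z_def sum_distrib_left mult.assoc)
    have "AE x in M. real_cond_exp M F (Z i) x = A m x * X i x * real_cond_exp M F (Y i) x"
      if "i \<in> I" for i
    proof -
      have [measurable]: "X i \<in> borel_measurable F" "Y i \<in> borel_measurable M"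
        using X[OF that] Y[OF that] by auto
      have "Z i = (\<lambda>x. (A m x * X i x) * Y i x)"
        using that by (simp add: Z_def[abs_def])
      with Z_int[of i] show ?thesis
        using real_cond_exp_mult[of "\<lambda>x. A m x * X i x" "Y i"] by auto
    qed
    then have "AE x in M. \<forall>i\<in>I. real_cond_exp M F (Z i) x = A m x * X i x * real_cond_exp M F (Y i) x"
      using I by (simp add: AE_finite_all)
    moreover have "AE x in M. real_cond_exp M F (\<lambda>x. A m x * ?S x) x = (\<Sum>i\<in>I. real_cond_exp M F (Z i) x)"
      unfolding sum_eq using Z_int by (rule real_cond_exp_sum)
    moreover have "AE x in M. real_cond_exp M F (\<lambda>x. A m x * ?S x) x = A m x * real_cond_exp M F ?S x"
      using S AS_int by (intro real_cond_exp_mult) auto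
    ultimately show ?thesis
      by eventually_elim (simp add: sum_distrib_left mult.assoc)
  qed
  \<comment> \<open>The countably many levels share one null set, so the level may afterwards be
    chosen separately at each point.\<close>
  then have "AE x in M. \<forall>m. A m x * real_cond_exp M F ?S x =
      A m x * (\<Sum>i\<in>I. X i x * real_cond_exp M F (Y i) x)"
    by (rule AE_all_countable[THEN iffD2, OF allI])
  then show ?thesis
  proof eventually_elim
    case (elim x)
    obtain m :: nat where m: "(\<Sum>i\<in>I. \<bar>X i x\<bar>) \<le> real m"
      using real_arch_simple by blast
    have "\<bar>X i x\<bar> \<le> real m" if "i \<in> I" for i
      using m member_le_sum[OF that, of "\<lambda>i. \<bar>X i x\<bar>"] I by simp
    then have "A m x = 1"
      by (simp add: A_def)
    with elim[rule_format, of m] show ?case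
      by simp
  qed
qed

lemma vec_cond_exp_nth: "vec_cond_exp M F Y x $ i = real_cond_exp M F (\<lambda>x. Y x $ i) x"
  by (simp add: vec_cond_exp_def)

lemma borel_measurable_vec_cond_exp [measurable]: "vec_cond_exp M F Y \<in> borel_measurable F"
  by (simp add: borel_measurable_vec_iff vec_cond_exp_nth)

lemma borel_measurable_vec_cond_exp2 [measurable]: "vec_cond_exp M F Y \<in> borel_measurable M"
  by (simp add: borel_measurable_vec_iff vec_cond_exp_nth)

section \<open>Conditional expectations of random vectors\<close>

context sigma_finite_subalgebra
begin

text \<open>This pulls matrices measurable in \<open>F\<close> out of a conditional expectation.
  Only the whole sum is assumed integrable, as in the backpropagation recursion, where second
  moments are available for the gradients but not for the contributions of single children.\<close>

lemma vec_cond_exp_sum_mult: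
  fixes X :: "'i \<Rightarrow> 'a \<Rightarrow> real ^ 'k::finite ^ 'm::finite"
  assumes I: "finite I"
    and X: "\<And>w i j. w \<in> I \<Longrightarrow> (\<lambda>x. X w x $ i $ j) \<in> borel_measurable F"
    and Y: "\<And>w. w \<in> I \<Longrightarrow> integrable M (Y w)"
    and S: "integrable M (\<lambda>x. \<Sum>w\<in>I. X w x *v Y w x)"
  shows "AE x in M. vec_cond_exp M F (\<lambda>x. \<Sum>w\<in>I. X w x *v Y w x) x =
    (\<Sum>w\<in>I. X w x *v vec_cond_exp M F (Y w) x)"
proof -
  \<comment> \<open>Each component is flattened into one scalar sum over pairs of a summand and a
    column, so that no partial sum has to be integrable.\<close>
  have nth: "(\<Sum>w\<in>I. X w x *v Z w) $ i = (\<Sum>(w, j)\<in>I \<times> UNIV. X w x $ i $ j * Z w $ j)" for x i Z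
    by (simp add: matrix_vector_mult_def sum.cartesian_product)
  have "AE x in M. real_cond_exp M F (\<lambda>x. (\<Sum>w\<in>I. X w x *v Y w x) $ i) x =
      (\<Sum>w\<in>I. X w x *v vec_cond_exp M F (Y w) x) $ i" for i
    unfolding nth vec_cond_exp_nth case_prod_beta
    using I X integrable_vec_nth[OF Y] integrable_vec_nth[OF S, of i, unfolded nth case_prod_beta]
    by (intro real_cond_exp_sum_mult) auto
  then have "AE x in M. \<forall>i. real_cond_exp M F (\<lambda>x. (\<Sum>w\<in>I. X w x *v Y w x) $ i) x =
      (\<Sum>w\<in>I. X w x *v vec_cond_exp M F (Y w) x) $ i"
    by (simp add: AE_all_countable)
  then show ?thesis
    by eventually_elim (simp add: vec_eq_iff vec_cond_exp_nth)
qed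

lemma vec_cond_exp_cong:
  fixes f g :: "'a \<Rightarrow> real ^ 'k::finite"
  assumes "AE x in M. f x = g x" "f \<in> borel_measurable M" "g \<in> borel_measurable M"
  shows "AE x in M. vec_cond_exp M F f x = vec_cond_exp M F g x"
proof -
  have "AE x in M. real_cond_exp M F (\<lambda>x. f x $ i) x = real_cond_exp M F (\<lambda>x. g x $ i) x" for i
    using assms by (intro real_cond_exp_cong) (auto simp: borel_measurable_vec_iff)
  then have "AE x in M. \<forall>i. real_cond_exp M F (\<lambda>x. f x $ i) x = real_cond_exp M F (\<lambda>x. g x $ i) x"
    by (simp add: AE_all_countable)
  then show ?thesis
    by eventually_elim (simp add: vec_eq_iff vec_cond_exp_nth)
qed

lemma vec_cond_exp_F_meas:
  fixes f :: "'a \<Rightarrow> real ^ 'k::finite"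
  assumes "integrable M f" "f \<in> borel_measurable F"
  shows "AE x in M. vec_cond_exp M F f x = f x"
proof -
  have "AE x in M. real_cond_exp M F (\<lambda>x. f x $ i) x = f x $ i" for i
    using assms by (intro real_cond_exp_F_meas) (auto simp: borel_measurable_vec_iff integrable_vec_nth)
  then have "AE x in M. \<forall>i. real_cond_exp M F (\<lambda>x. f x $ i) x = f x $ i"
    by (simp add: AE_all_countable)
  then show ?thesis
    by eventually_elim (simp add: vec_eq_iff vec_cond_exp_nth)
qed

lemma vec_cond_exp_nested_subalg:
  fixes f :: "'a \<Rightarrow> real ^ 'k::finite"
  assumes "subalgebra M G" "subalgebra G F" "integrable M f"
  shows "AE x in M. vec_cond_exp M F (vec_cond_exp M G f) x = vec_cond_exp M F f x"
proof -
  have "AE x in M. real_cond_exp M F (real_cond_exp M G (\<lambda>x. f x $ i)) x =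
      real_cond_exp M F (\<lambda>x. f x $ i) x" for i
    using assms by (intro real_cond_exp_nested_subalg integrable_vec_nth)
  then have "AE x in M. \<forall>i. real_cond_exp M F (real_cond_exp M G (\<lambda>x. f x $ i)) x =
      real_cond_exp M F (\<lambda>x. f x $ i) x"
    by (simp add: AE_all_countable)
  then show ?thesis
    by eventually_elim (simp add: vec_eq_iff vec_cond_exp_nth)
qed

end

section \<open>Orthogonal decomposition of the second moment\<close>

context finite_measure_subalgebra
begin

text \<open>The residual \<open>X - C\<close> is orthogonal to \<open>C\<close>, because the
  integrals of \<open>C X\<close> and of \<open>C\<close> squared agree. The last term is the exact
  variance lost by conditioning.\<close>

lemma real_cond_exp_pythagoras:
  fixes X :: "'a \<Rightarrow> real"
  assumes [measurable]: "X \<in> borel_measurable M" and X2: "integrable M (\<lambda>x. (X x)\<^sup>2)"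
  defines "C \<equiv> real_cond_exp M F X"
  shows "integrable M (\<lambda>x. (C x)\<^sup>2)"
    and "integrable M (\<lambda>x. (X x - C x)\<^sup>2)"
    and "(\<integral>x. (X x)\<^sup>2 \<partial>M) = (\<integral>x. (C x)\<^sup>2 \<partial>M) + (\<integral>x. (X x - C x)\<^sup>2 \<partial>M)"
proof -
  have [measurable]: "C \<in> borel_measurable M" "C \<in> borel_measurable F"
    by (auto simp: C_def)
  have X: "integrable M X"
    by (rule square_integrable_imp_integrable) (use X2 in auto)
  \<comment> \<open>Conditional Jensen inequality for the convex square function.\<close>
  show C2: "integrable M (\<lambda>x. (C x)\<^sup>2)"
    unfolding C_def using X X2
    by (intro integrable_convex_cond_exp[where I = UNIV]) (auto simp: convex_power2)
  have CX: "integrable M (\<lambda>x. C x * X x)"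
    by (rule Bochner_Integration.integrable_bound[OF Bochner_Integration.integrable_add[OF C2 X2]])
      (auto intro!: abs_mult_le_sum_squares)
  \<comment> \<open>\<open>C\<close> is measurable in \<open>F\<close>, so \<open>X\<close> may be
    replaced by its conditional expectation under the integral.\<close>
  have CX_eq: "(\<integral>x. C x * X x \<partial>M) = (\<integral>x. (C x)\<^sup>2 \<partial>M)"
    using real_cond_exp_intg(2)[OF CX] by (simp add: C_def power2_eq_square)
  have diff: "(\<lambda>x. (X x - C x)\<^sup>2) = (\<lambda>x. (X x)\<^sup>2 + (C x)\<^sup>2 - 2 * (C x * X x))"
    by (auto simp: power2_eq_square algebra_simps)
  show "integrable M (\<lambda>x. (X x - C x)\<^sup>2)"
    unfolding diff using X2 C2 CX by simp
  show "(\<integral>x. (X x)\<^sup>2 \<partial>M) = (\<integral>x. (C x)\<^sup>2 \<partial>M) + (\<integral>x. (X x - C x)\<^sup>2 \<partial>M)"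
    unfolding diff using X2 C2 CX CX_eq by simp
qed

lemma vec_cond_exp_pythagoras:
  fixes Y :: "'a \<Rightarrow> real ^ 'k::finite"
  assumes Y [measurable]: "Y \<in> borel_measurable M" and Y2: "integrable M (\<lambda>x. (norm (Y x))\<^sup>2)"
  defines "C \<equiv> vec_cond_exp M F Y"
  shows "integrable M (\<lambda>x. (norm (C x))\<^sup>2)"
    and "integrable M (\<lambda>x. (norm (Y x - C x))\<^sup>2)"
    and "(\<integral>x. (norm (Y x))\<^sup>2 \<partial>M) = (\<integral>x. (norm (C x))\<^sup>2 \<partial>M) + (\<integral>x. (norm (Y x - C x))\<^sup>2 \<partial>M)"
proof -
  have Yi: "(\<lambda>x. Y x $ i) \<in> borel_measurable M" "integrable M (\<lambda>x. (Y x $ i)\<^sup>2)" for i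
    using Y Y2 by (simp_all add: integrable_norm_power2_iff borel_measurable_vec_iff)
  note P = real_cond_exp_pythagoras[OF Yi, folded vec_cond_exp_nth[of M F Y], folded C_def]
  show "integrable M (\<lambda>x. (norm (C x))\<^sup>2)" "integrable M (\<lambda>x. (norm (Y x - C x))\<^sup>2)"
    using P by (simp_all add: norm_vec_power2)
  show "(\<integral>x. (norm (Y x))\<^sup>2 \<partial>M) = (\<integral>x. (norm (C x))\<^sup>2 \<partial>M) + (\<integral>x. (norm (Y x - C x))\<^sup>2 \<partial>M)"
    using P Yi by (simp add: norm_vec_power2 Bochner_Integration.integral_sum sum.distrib)
qed

lemma integral_vec_cond_exp:
  fixes Y :: "'a \<Rightarrow> real ^ 'k::finite"
  assumes "integrable M Y"
  shows "integrable M (vec_cond_exp M F Y)"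
    and "(\<integral>x. vec_cond_exp M F Y x \<partial>M) = (\<integral>x. Y x \<partial>M)"
proof -
  \<comment> \<open>Expansion in the unit vectors reduces integrability of the vector to that of its
    real components.\<close>
  have eq: "vec_cond_exp M F Y x = (\<Sum>i\<in>UNIV. real_cond_exp M F (\<lambda>x. Y x $ i) x *\<^sub>R axis i 1)" for x
    by (simp add: vec_eq_iff vec_cond_exp_nth axis_def if_distrib cong: if_cong)
  show int: "integrable M (vec_cond_exp M F Y)"
    unfolding eq[abs_def]
    by (intro Bochner_Integration.integrable_sum integrable_scaleR_left real_cond_exp_int(1)
        integrable_vec_nth[OF assms])
  show "(\<integral>x. vec_cond_exp M F Y x \<partial>M) = (\<integral>x. Y x \<partial>M)"
    by (simp add: vec_eq_iff integral_vec_nth[OF int] integral_vec_nth[OF assms] vec_cond_exp_nth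
        real_cond_exp_int(2)[OF integrable_vec_nth[OF assms]])
qed

end


section \<open>Empirical means\<close>

text \<open>Nonnegativity of the variance, summed over the components. It ensures that the variance
  expressions below are not cut off at zero when they are passed to \<open>ennreal\<close>.\<close>

lemma (in prob_space) norm_integral_power2_le:
  fixes Y :: "'a \<Rightarrow> real ^ 'k::finite"
  assumes Y: "Y \<in> borel_measurable M" and Y2: "integrable M (\<lambda>x. (norm (Y x))\<^sup>2)"
  shows "(norm (\<integral>x. Y x \<partial>M))\<^sup>2 \<le> (\<integral>x. (norm (Y x))\<^sup>2 \<partial>M)"
proof -
  note Yint = integrable_of_norm_power2[OF Y Y2]
  have Y2i: "integrable M (\<lambda>x. (Y x $ i)\<^sup>2)" for i
    using Y2 by (simp add: integrable_norm_power2_iff[OF Y])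
  have "(\<integral>x. Y x $ i \<partial>M)\<^sup>2 \<le> (\<integral>x. (Y x $ i)\<^sup>2 \<partial>M)" for i
    using variance_eq[OF integrable_vec_nth[OF Yint] Y2i] variance_positive[of "\<lambda>x. Y x $ i"]
    by simp
  then show ?thesis
    using Y2i by (simp add: norm_vec_power2 integral_vec_nth[OF Yint] Bochner_Integration.integral_sum sum_mono)
qed

text \<open>The estimator is unbiased by the choice of \<open>m\<close>, so its error is its
  variance. The centred samples are independent, hence of the \<open>n\<close> times
  \<open>n\<close> products only the diagonal ones contribute, and division by the square of
  \<open>n\<close> leaves the variance of one sample over \<open>n\<close>.\<close>

lemma (in prob_space) mean_sq_error_eq:
  fixes Y :: "'a \<Rightarrow> real ^ 'k::finite"
  assumes Y [measurable]: "Y \<in> borel_measurable M" and Y2: "integrable M (\<lambda>x. (norm (Y x))\<^sup>2)"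
    and m: "m = (\<integral>x. Y x \<partial>M)" and n: "n \<ge> 1"
  shows "mean_sq_error M n Y m = ennreal (((\<integral>x. (norm (Y x))\<^sup>2 \<partial>M) - (norm m)\<^sup>2) / real n)"
proof -
  interpret P: product_prob_space "\<lambda>_ :: nat. M" "{..<n}" ..
  let ?P = "PiM {..<n} (\<lambda>_. M)"
  note Yint = integrable_of_norm_power2[OF Y Y2]
  define Z where "Z i x = Y x $ i - m $ i" for i x
  have Z [measurable]: "Z i \<in> borel_measurable M" for i
    using Y unfolding Z_def[abs_def] borel_measurable_vec_iff by (intro borel_measurable_diff) auto
  have Zint: "integrable M (Z i)" for i
    using integrable_vec_nth[OF Yint] by (simp add: Z_def[abs_def])
  have Zmean: "(\<integral>x. Z i x \<partial>M) = 0" for i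
    using integrable_vec_nth[OF Yint] by (simp add: Z_def m integral_vec_nth[OF Yint] prob_space)
  have Y2i: "integrable M (\<lambda>x. (Y x $ i)\<^sup>2)" for i
    using Y2 by (simp add: integrable_norm_power2_iff)
  have Z2: "(\<lambda>x. (Z i x)\<^sup>2) = (\<lambda>x. (Y x $ i)\<^sup>2 - 2 * m $ i * Y x $ i + (m $ i)\<^sup>2)" for i
    by (auto simp: Z_def power2_eq_square algebra_simps)
  have Z2int: "integrable M (\<lambda>x. (Z i x)\<^sup>2)" for i
    unfolding Z2 using Y2i integrable_vec_nth[OF Yint] by simp
  have Z2val: "(\<integral>x. (Z i x)\<^sup>2 \<partial>M) = (\<integral>x. (Y x $ i)\<^sup>2 \<partial>M) - (m $ i)\<^sup>2" for i
    unfolding Z2 using Y2i integrable_vec_nth[OF Yint]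
    by (simp add: prob_space) (simp add: m integral_vec_nth[OF Yint] power2_eq_square)
  have cross: "integrable ?P (\<lambda>s. Z i (s k) * Z i (s l))"
      "(\<integral>s. Z i (s k) * Z i (s l) \<partial>?P) = (if k = l then \<integral>x. (Z i x)\<^sup>2 \<partial>M else 0)"
    if kl: "k < n" "l < n" for i k l
  proof -
    \<comment> \<open>\<open>f\<close> writes the product of two coordinate functions as a product
      over all factors of the product space. For \<open>k = l\<close> both factors fall on the same
      coordinate and give the square.\<close>
    define f where "f j x = (if j = k then Z i x else 1) * (if j = l then Z i x else 1)" for j x
    have f_int: "integrable M (f j)" for j
      using Zint[of i] Z2int[of i]
      by (cases "j = k"; cases "j = l") (simp_all add: f_def[abs_def] power2_eq_square)
    have f_prod: "(\<Prod>j<n. f j (s j)) = Z i (s k) * Z i (s l)" for s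
      using kl by (simp add: f_def prod.distrib prod.delta')
    have f_val: "(\<integral>x. f j x \<partial>M) = (if j = k \<and> j = l then \<integral>x. (Z i x)\<^sup>2 \<partial>M else if j = k \<or> j = l then 0 else 1)" for j
      using Zmean[of i] by (simp add: f_def prob_space power2_eq_square)
    show "integrable ?P (\<lambda>s. Z i (s k) * Z i (s l))"
      using P.product_integrable_prod[of "{..<n}" f] f_int by (simp add: f_prod)
    have "(\<integral>s. Z i (s k) * Z i (s l) \<partial>?P) = (\<Prod>j<n. \<integral>x. f j x \<partial>M)"
      using P.product_integral_prod[of "{..<n}" f] f_int by (simp add: f_prod)
    also have "\<dots> = (if k = l then \<integral>x. (Z i x)\<^sup>2 \<partial>M else 0)"
    proof (cases "k = l")
      case True
      then show ?thesis
        using kl by (simp add: f_val prod.delta cong: if_cong)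
    next
      \<comment> \<open>The factor at \<open>k\<close> has integral zero by \<open>Zmean\<close>,
        which annihilates the product.\<close>
      case False
      then show ?thesis
        using kl by (auto simp: f_val intro!: prod_zero bexI[of _ k])
    qed
    finally show "(\<integral>s. Z i (s k) * Z i (s l) \<partial>?P) = (if k = l then \<integral>x. (Z i x)\<^sup>2 \<partial>M else 0)" .
  qed
  \<comment> \<open>Since \<open>n \<ge> 1\<close>, the vector \<open>m\<close> can be moved inside
    the average, which then averages the centred terms.\<close>
  have expand: "(norm (emp_mean n Y s - m))\<^sup>2 =
      (\<Sum>i\<in>UNIV. \<Sum>k<n. \<Sum>l<n. Z i (s k) * Z i (s l)) / (real n)\<^sup>2" for s
  proof -
    have "(emp_mean n Y s - m) $ i = (\<Sum>k<n. Z i (s k)) / real n" for i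
      using n by (simp add: emp_mean_def Z_def sum_subtractf field_simps)
    then show ?thesis
      unfolding norm_vec_power2
      by (simp add: power_divide sum_divide_distrib[symmetric] sum_product power2_eq_square
          del: vector_minus_component)
  qed
  have "integrable ?P (\<lambda>s. (norm (emp_mean n Y s - m))\<^sup>2)"
    unfolding expand using cross(1) by (intro integrable_divide_zero Bochner_Integration.integrable_sum) auto
  then have "mean_sq_error M n Y m = ennreal (\<integral>s. (norm (emp_mean n Y s - m))\<^sup>2 \<partial>?P)"
    unfolding mean_sq_error_def by (intro nn_integral_eq_integral) auto
  also have "(\<integral>s. (norm (emp_mean n Y s - m))\<^sup>2 \<partial>?P) =
      (\<integral>s. (\<Sum>i\<in>UNIV. \<Sum>k<n. \<Sum>l<n. Z i (s k) * Z i (s l)) \<partial>?P) / (real n)\<^sup>2"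
    unfolding expand by (rule integral_divide_zero)
  also have "(\<integral>s. (\<Sum>i\<in>UNIV. \<Sum>k<n. \<Sum>l<n. Z i (s k) * Z i (s l)) \<partial>?P) =
      (\<Sum>i\<in>UNIV. \<integral>s. (\<Sum>k<n. \<Sum>l<n. Z i (s k) * Z i (s l)) \<partial>?P)"
    using cross(1) by (intro Bochner_Integration.integral_sum Bochner_Integration.integrable_sum) auto
  also have "\<dots> = (\<Sum>i\<in>UNIV. \<Sum>k<n. \<integral>s. (\<Sum>l<n. Z i (s k) * Z i (s l)) \<partial>?P)"
    using cross(1)
    by (intro sum.cong refl Bochner_Integration.integral_sum Bochner_Integration.integrable_sum) auto
  also have "\<dots> = (\<Sum>i\<in>UNIV. \<Sum>k<n. \<Sum>l<n. \<integral>s. Z i (s k) * Z i (s l) \<partial>?P)"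
    using cross(1) by (intro sum.cong refl Bochner_Integration.integral_sum) auto
  also have "\<dots> = (\<Sum>i\<in>UNIV. real n * (\<integral>x. (Z i x)\<^sup>2 \<partial>M))"
    by (simp add: cross(2))
  also have "\<dots> / (real n)\<^sup>2 = ((\<integral>x. (norm (Y x))\<^sup>2 \<partial>M) - (norm m)\<^sup>2) / real n"
    using n Y2i
    by (simp add: norm_vec_power2 Z2val sum_distrib_left[symmetric] power2_eq_square[of "real n"]
        Bochner_Integration.integral_sum sum_subtractf)
  finally show ?thesis .
qed


section \<open>Measurability of Jacobians\<close>

text \<open>A partial derivative is a pointwise limit of difference quotients, each measurable by
  \<open>meas\<close>. The base point \<open>c a\<close> may vary with the parameter because the
  local Jacobians are taken at the random observation itself.\<close>

lemma borel_measurable_jacobian: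
  fixes f :: "'a \<Rightarrow> real ^ 'k::finite \<Rightarrow> real ^ 'm::finite"
  assumes diff: "\<And>a. a \<in> space M \<Longrightarrow> f a differentiable at (c a)"
    and meas: "\<And>d. (\<lambda>a. f a (c a + d)) \<in> borel_measurable M"
  shows "(\<lambda>a. jacobian (f a) (at (c a)) $ i $ j) \<in> borel_measurable M"
proof (rule borel_measurable_LIMSEQ_real)
  \<comment> \<open>The term \<open>c a + 0\<close> is left unsimplified so that it is the instance
    \<open>d = 0\<close> of \<open>meas\<close>.\<close>
  let ?u = "\<lambda>n a. (f a (c a + inverse (real (Suc n)) *\<^sub>R axis j 1) $ i - f a (c a + 0) $ i) / inverse (real (Suc n))"
  show "?u n \<in> borel_measurable M" for n
    using meas by (intro borel_measurable_divide borel_measurable_diff) (simp_all add: borel_measurable_vec_iff del: add_0_right)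
  fix a assume "a \<in> space M"
  define D where "D = frechet_derivative (f a) (at (c a))"
  have D: "(f a has_derivative D) (at (c a))"
    using diff[OF \<open>a \<in> space M\<close>] by (simp add: D_def frechet_derivative_works)
  have "((\<lambda>t. f a (c a + t *\<^sub>R axis j 1)) has_derivative (\<lambda>t. D (t *\<^sub>R axis j 1))) (at 0)"
    by (rule has_derivative_compose[of "\<lambda>t. c a + t *\<^sub>R axis j 1" _ 0 UNIV "f a" D])
      (auto intro!: derivative_eq_intros simp: D)
  then have "((\<lambda>t. f a (c a + t *\<^sub>R axis j 1) $ i) has_derivative (\<lambda>t. D (t *\<^sub>R axis j 1) $ i)) (at 0)"
    by (rule bounded_linear.has_derivative[OF bounded_linear_vec_nth])
  moreover have "D (t *\<^sub>R axis j 1) $ i = D (axis j 1) $ i * t" for t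
    using linear_scale[OF has_derivative_linear[OF D]] by simp
  ultimately have "((\<lambda>t. f a (c a + t *\<^sub>R axis j 1) $ i) has_field_derivative D (axis j 1) $ i) (at 0)"
    by (simp add: has_field_derivative_def)
  then have "((\<lambda>t. (f a (c a + t *\<^sub>R axis j 1) $ i - f a (c a + 0) $ i) / t) \<longlongrightarrow> D (axis j 1) $ i) (at 0)"
    by (simp add: DERIV_def)
  \<comment> \<open>The filter \<open>at 0\<close> excludes zero itself, and the chosen steps never
    vanish.\<close>
  moreover have "filterlim (\<lambda>n. inverse (real (Suc n))) (at 0) sequentially"
    unfolding filterlim_at using LIMSEQ_inverse_real_of_nat by (simp add: add.commute)
  ultimately have "(\<lambda>n. ?u n a) \<longlonglongrightarrow> D (axis j 1) $ i"
    by (rule filterlim_compose)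
  then show "(\<lambda>n. ?u n a) \<longlonglongrightarrow> jacobian (f a) (at (c a)) $ i $ j"
    by (simp add: jacobian_def matrix_def D_def)
qed

section \<open>Sigma-algebras of observations\<close>

lemma subalgebra_vimage_algebra:
  assumes "f \<in> measurable M K"
  shows "subalgebra M (vimage_algebra (space M) f K)"
  using sets_image_in_sets[OF refl assms] by (simp add: subalgebra_def)

lemma finite_measure_subalgebraI:
  "prob_space M \<Longrightarrow> subalgebra M F \<Longrightarrow> finite_measure_subalgebra M F"
  by (simp add: finite_measure_subalgebra_def finite_measure_subalgebra_axioms_def prob_space_def)

lemma
  assumes "subalgebra M F" "subalgebra M G"
  shows subalgebra_sigma_join: "subalgebra M (sigma_join F G)"
    and sigma_join_subalgebra: "subalgebra (sigma_join F G) F"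
proof -
  have space: "space F = space M" "space G = space M" and sets: "sets F \<union> sets G \<subseteq> sets M"
    using assms by (auto simp: subalgebra_def)
  then have "sets F \<union> sets G \<subseteq> Pow (space F)"
    using sets.space_closed[of M] by auto
  with space sets show "subalgebra M (sigma_join F G)" "subalgebra (sigma_join F G) F"
    using sets.sigma_sets_subset[OF sets]
    by (auto simp: subalgebra_def sigma_join_def sets_measure_of space_measure_of)
qed

context layered_net
begin

lemma vals_measurable:
  assumes "\<And>u. u \<in> W \<Longrightarrow> val N u \<in> borel_measurable (omega N)"
  shows "vals N W \<in> borel_measurable (omega N)"
proof -
  have "(\<lambda>\<omega>. vals N W \<omega> $ u) \<in> borel_measurable (omega N)" for u
    using assms by (cases "u \<in> W") (auto simp: vals_def)
  then show ?thesis
    by (subst borel_measurable_vec_iff) simp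
qed

text \<open>Measurability is assumed at input nodes only. It spreads through the layers because a
  value is a measurable local map applied to parent values and an auxiliary variable.\<close>

lemma val_measurable: "val N v \<in> borel_measurable (omega N)"
proof (induction "layer N v" arbitrary: v rule: less_induct)
  case less
  show ?case
  proof (cases "input_node N v")
    case True
    then show ?thesis
      by (rule input_measurable)
  next
    case False
    have "vals N (pa N v) \<in> borel_measurable (omega N)"
    proof (rule vals_measurable)
      fix u assume "u \<in> pa N v"
      then have "layer N u < layer N v"
        using edge_layer[of u v] by (simp add: pa_def)
      then show "val N u \<in> borel_measurable (omega N)"
        by (rule less)
    qed
    then have "obs N v \<in> measurable (omega N) (obs_space N v)"
      using False aux_measurable[of v] unfolding obs_def[abs_def] obs_space_def by simp
    then have "(\<lambda>\<omega>. local_map N v (obs N v \<omega>) (param N v)) \<in> borel_measurable (omega N)"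
      by (rule measurable_compose[OF _ local_map_measurable[OF False]])
    then show ?thesis
      by (subst measurable_cong[OF val_eq[OF False]])
  qed
qed

lemma obs_measurable: "obs N v \<in> measurable (omega N) (obs_space N v)"
  using vals_measurable[OF val_measurable] aux_measurable[of v]
  unfolding obs_def[abs_def] obs_space_def by simp

lemma subalgebra_sigma_obs: "subalgebra (omega N) (sigma_obs N U)"
  unfolding sigma_obs_def by (intro subalgebra_vimage_algebra measurable_restrict obs_measurable)

lemma obs_measurable_sigma_obs:
  assumes "w \<in> U"
  shows "obs N w \<in> measurable (sigma_obs N U) (obs_space N w)"
proof -
  have "(\<lambda>\<omega>. \<lambda>u\<in>U. obs N u \<omega>) \<in> space (omega N) \<rightarrow> space (PiM U (obs_space N))"
    using measurable_space[OF obs_measurable] by (auto simp: space_PiM)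
  then have "(\<lambda>\<omega>. \<lambda>u\<in>U. obs N u \<omega>) \<in> measurable (sigma_obs N U) (PiM U (obs_space N))"
    unfolding sigma_obs_def by (rule measurable_vimage_algebra1)
  from measurable_compose[OF this measurable_component_singleton[OF assms]] show ?thesis
    using assms by simp
qed

lemma sigma_obs_mono:
  assumes "U \<subseteq> U'"
  shows "subalgebra (sigma_obs N U') (sigma_obs N U)"
proof -
  have "(\<lambda>\<omega>. \<lambda>u\<in>U. obs N u \<omega>) \<in> measurable (sigma_obs N U') (PiM U (obs_space N))"
    using assms by (intro measurable_restrict obs_measurable_sigma_obs) auto
  from subalgebra_vimage_algebra[OF this] show ?thesis
    by (simp add: sigma_obs_def)
qed

lemma finite_measure_subalgebra_sigma_obs: "finite_measure_subalgebra (omega N) (sigma_obs N U)"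
  by (rule finite_measure_subalgebraI[OF prob subalgebra_sigma_obs])

lemma subalgebra_source:
  assumes "feedback_source S \<or> stochastic_source S \<or> sparsity_source v S"
  shows "subalgebra (omega N) S"
  using assms subalgebra_vimage_algebra[OF aux_measurable]
    subalgebra_vimage_algebra[OF vals_measurable[OF val_measurable]]
  by (auto simp: feedback_source_def stochastic_source_def sparsity_source_def sigma_aux_def sigma_vals_def)


section \<open>Jacobians and gradients\<close>

lemma child_not_input: "w \<in> ch N v \<Longrightarrow> \<not> input_node N w"
  by (auto simp: ch_def input_node_def dest: edge_layer)

lemma local_map_differentiable_at:
  assumes "\<not> input_node N v" "e \<in> space (aux_space N v)"
  shows "(\<lambda>(y, t). local_map N v (y, e) t) differentiable (at x)"
  using local_map_differentiable[OF assms] unfolding differentiable_on_def by (rule bspec) (rule UNIV_I)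

text \<open>Replacing block \<open>v\<close> is an affine operation: \<open>a\<close> enters as a
  shift along \<open>axis v\<close>. The chain rule thus gives differentiability in
  \<open>a\<close>, and evaluation at a displaced point becomes the local map after a measurable
  translation of the observation.\<close>

lemma jac_measurable:
  assumes w: "\<not> input_node N w"
  shows "(\<lambda>zz. jac v w zz $ i $ j) \<in> borel_measurable (obs_space N w)"
proof -
  define upd :: "real ^ 'n ^ 'v \<Rightarrow> real ^ 'n \<Rightarrow> real ^ 'n ^ 'v"
    where "upd y a = (\<chi> u. if u = v then a else y $ u)" for y a
  have upd: "upd y a = y + axis v (a - y $ v)" for y a
    by (auto simp: upd_def vec_eq_iff axis_def)
  have bl: "bounded_linear (axis v :: real ^ 'n \<Rightarrow> real ^ 'n ^ 'v)"
    unfolding linear_conv_bounded_linear[symmetric]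
    by (rule linearI) (auto simp: vec_eq_iff axis_def)
  \<comment> \<open>The indices \<open>j\<close> and \<open>i\<close> are exchanged because
    \<open>jac\<close> is the transposed Jacobian.\<close>
  have "(\<lambda>zz. jacobian (\<lambda>a. local_map N w (upd (fst zz) a, snd zz) (param N w)) (at (fst zz $ v)) $ j $ i)
      \<in> borel_measurable (obs_space N w)"
  proof (rule borel_measurable_jacobian)
    fix zz assume "zz \<in> space (obs_space N w)"
    then have e: "snd zz \<in> space (aux_space N w)"
      by (auto simp: obs_space_def space_pair_measure)
    have "(\<lambda>a. (upd (fst zz) a, param N w)) differentiable (at a)" for a
    proof -
      have "((\<lambda>a. axis v (a - fst zz $ v)) has_derivative axis v) (at a)"
        by (rule bounded_linear.has_derivative[OF bl]) (auto intro!: derivative_eq_intros)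
      then have "((\<lambda>a. (upd (fst zz) a, param N w)) has_derivative (\<lambda>h. (axis v h, 0))) (at a)"
        unfolding upd by (auto intro!: derivative_eq_intros)
      then show ?thesis
        by (rule differentiableI)
    qed
    from differentiable_chain_at[OF this local_map_differentiable_at[OF w e]]
    show "(\<lambda>a. local_map N w (upd (fst zz) a, snd zz) (param N w)) differentiable (at (fst zz $ v))"
      by (simp add: o_def)
  next
    fix d
    have "(\<lambda>zz. (fst zz + axis v d, snd zz)) \<in> measurable (obs_space N w) (obs_space N w)"
      unfolding obs_space_def by measurable
    from measurable_compose[OF this local_map_measurable[OF w]]
    show "(\<lambda>zz. local_map N w (upd (fst zz) (fst zz $ v + d), snd zz) (param N w))
        \<in> borel_measurable (obs_space N w)"
      by (simp add: upd)
  qed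
  then show ?thesis
    by (simp add: jac_def transpose_def upd_def)
qed

lemma jac_param_measurable:
  assumes v: "\<not> input_node N v"
  shows "(\<lambda>zz. jac_param v zz $ i $ j) \<in> borel_measurable (obs_space N v)"
proof -
  have "(\<lambda>zz. jacobian (\<lambda>t. local_map N v zz t) (at (param N v)) $ j $ i) \<in> borel_measurable (obs_space N v)"
  proof (rule borel_measurable_jacobian)
    fix zz assume "zz \<in> space (obs_space N v)"
    then have e: "snd zz \<in> space (aux_space N v)"
      by (auto simp: obs_space_def space_pair_measure)
    have "(\<lambda>t. (fst zz, t)) differentiable (at t)" for t :: "real ^ 'p"
      by (rule differentiableI[of _ "\<lambda>h. (0, h)"]) (auto intro!: derivative_eq_intros)
    from differentiable_chain_at[OF this local_map_differentiable_at[OF v e]]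
    show "(\<lambda>t. local_map N v zz t) differentiable (at (param N v))"
      by (simp add: o_def)
  qed (rule local_map_measurable[OF v])
  then show ?thesis
    by (simp add: jac_param_def transpose_def)
qed

lemma jac_obs_measurable:
  assumes "w \<in> U" "\<not> input_node N w"
  shows "(\<lambda>\<omega>. jac v w (obs N w \<omega>) $ i $ j) \<in> borel_measurable (sigma_obs N U)"
  by (rule measurable_compose[OF obs_measurable_sigma_obs jac_measurable]) fact+

lemma jac_param_obs_measurable:
  assumes "v \<in> U" "\<not> input_node N v"
  shows "(\<lambda>\<omega>. jac_param v (obs N v \<omega>) $ i $ j) \<in> borel_measurable (sigma_obs N U)"
  by (rule measurable_compose[OF obs_measurable_sigma_obs jac_param_measurable]) fact+

lemma jac_sum_measurable:
  assumes "\<And>w. w \<in> ch N v \<Longrightarrow> Y w \<in> borel_measurable (omega N)"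
  shows "(\<lambda>\<omega>. \<Sum>w\<in>ch N v. jac v w (obs N w \<omega>) *v Y w \<omega>) \<in> borel_measurable (omega N)"
  using assms child_not_input
  by (intro borel_measurable_sum borel_measurable_matrix_vector_mult
      measurable_compose[OF obs_measurable jac_measurable])

lemma grad_measurable: "grad v \<in> borel_measurable (omega N)"
proof (induction v rule: grad.induct)
  case (1 v)
  show ?case
  proof (cases "terminal_node N v")
    case True
    then show ?thesis
      using feedback_measurable by (subst grad.simps) simp
  next
    case False
    then show ?thesis
      using jac_sum_measurable[OF "1.IH"] by (subst grad.simps) simp
  qed
qed

lemma syn_grad_measurable: "syn_grad v \<in> borel_measurable (omega N)"
  using grad_measurable[of v]
    jac_sum_measurable[of v "\<lambda>w. vec_cond_exp (omega N) (sigma_obs N {w}) (syn_grad w)"]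
  by (subst syn_grad.simps) auto

lemma grad_param_measurable: "\<not> input_node N v \<Longrightarrow> grad_param v \<in> borel_measurable (omega N)"
  unfolding grad_param_def[abs_def]
  by (intro borel_measurable_matrix_vector_mult measurable_compose[OF obs_measurable jac_param_measurable]
      grad_measurable)

lemma syn_grad_param_measurable: "\<not> input_node N v \<Longrightarrow> syn_grad_param v \<in> borel_measurable (omega N)"
  unfolding syn_grad_param_def[abs_def]
  by (intro borel_measurable_matrix_vector_mult measurable_compose[OF obs_measurable jac_param_measurable]
      syn_grad_measurable)

lemma grad_nonterminal:
  "\<not> terminal_node N v \<Longrightarrow> grad v = (\<lambda>\<omega>. \<Sum>w\<in>ch N v. jac v w (obs N w \<omega>) *v grad w \<omega>)"
  by (subst grad.simps) simp

lemma syn_grad_nonterminal: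
  "\<not> terminal_node N v \<Longrightarrow> syn_grad v = (\<lambda>\<omega>. \<Sum>w\<in>ch N v. jac v w (obs N w \<omega>) *v
    vec_cond_exp (omega N) (sigma_obs N {w}) (syn_grad w) \<omega>)"
  by (subst syn_grad.simps) simp

text \<open>All children of \<open>v\<close> share the parent \<open>v\<close> with
  \<open>w\<close>, so they are siblings of \<open>w\<close>. The node \<open>v\<close> enters
  through the recursion at the parent \<open>v\<close> of \<open>w\<close>; this needs
  \<open>v\<close> to be non-input, since \<open>an_sib\<close> is empty at inputs. Condition (B) at
  \<open>w\<close> therefore covers the whole family.\<close>

lemma family_subset_an_sib:
  assumes v: "\<not> input_node N v" and w: "w \<in> ch N v"
  shows "insert v (ch N v) \<subseteq> an_sib w"
proof -
  have "sib u \<subseteq> an_sib u" if "\<not> input_node N u" for u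
    using that by (subst an_sib.simps) simp
  then have sib: "sib v \<subseteq> an_sib v" "sib w \<subseteq> an_sib w"
    using v child_not_input[OF w] by auto
  have "v \<in> an_sib v"
    using sib(1) by (auto simp: sib_def)
  moreover have "an_sib v \<subseteq> an_sib w"
  proof -
    have "w \<in> sib w" "v \<in> pa N w"
      using w by (auto simp: sib_def pa_def ch_def)
    then show ?thesis
      using child_not_input[OF w] by (subst (2) an_sib.simps) auto
  qed
  moreover have "ch N v \<subseteq> sib w"
  proof
    fix w' assume w': "w' \<in> ch N v"
    then have "layer N w' = layer N w" "v \<in> pa N w' \<inter> pa N w"
      using w edge_layer[of v w] edge_layer[of v w'] by (auto simp: ch_def pa_def)
    then show "w' \<in> sib w"
      by (auto simp: sib_def)
  qed
  ultimately show ?thesis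
    using sib(2) by auto
qed

section \<open>Synthetic gradients as conditional expectations\<close>

context
  assumes moments: finite_second_moments and B: condition_B
begin

lemma grad_integrable: "integrable (omega N) (grad v)"
  using moments finite_measure.integrable_of_norm_power2[OF prob_space.finite_measure[OF prob] grad_measurable]
  by (auto simp: finite_second_moments_def)

lemma grad_param_square_integrable:
  "\<not> input_node N v \<Longrightarrow> integrable (omega N) (\<lambda>\<omega>. (norm (grad_param v \<omega>))\<^sup>2)"
  using moments by (auto simp: finite_second_moments_def)

lemma grad_param_integrable: "\<not> input_node N v \<Longrightarrow> integrable (omega N) (grad_param v)"
  by (intro finite_measure.integrable_of_norm_power2[OF prob_space.finite_measure[OF prob]]
      grad_param_measurable grad_param_square_integrable)

text \<open>Condition (B) replaces the separate conditioning on each child's observation by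
  conditioning on one common sigma-algebra \<open>?H\<close>. The Jacobians at all children are
  measurable in \<open>?H\<close>, so the sum of the recursion can be taken inside a single
  conditional expectation.\<close>

lemma syn_grad_eq_cond_exp_grad_of_children:
  assumes v: "\<not> input_node N v" "\<not> terminal_node N v"
    and IH: "\<And>w. w \<in> ch N v \<Longrightarrow> AE \<omega> in omega N.
      vec_cond_exp (omega N) (sigma_obs N {w}) (syn_grad w) \<omega> =
      vec_cond_exp (omega N) (sigma_obs N {w}) (grad w) \<omega>"
  shows "AE \<omega> in omega N.
    syn_grad v \<omega> = vec_cond_exp (omega N) (sigma_obs N (insert v (ch N v))) (grad v) \<omega>"
proof -
  let ?H = "sigma_obs N (insert v (ch N v))"
  interpret H: finite_measure_subalgebra "omega N" ?H
    by (rule finite_measure_subalgebra_sigma_obs)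
  have "AE \<omega> in omega N. vec_cond_exp (omega N) (sigma_obs N {w}) (syn_grad w) \<omega> =
      vec_cond_exp (omega N) ?H (grad w) \<omega>" if w: "w \<in> ch N v" for w
  proof -
    \<comment> \<open>\<open>condition_B\<close> conditions on \<open>insert w U\<close>; as
      \<open>w\<close> already lies in the family, the result is the same sigma-algebra for every
      child.\<close>
    have "insert w (insert v (ch N v)) = insert v (ch N v)"
      using w by auto
    with B[unfolded condition_B_def, rule_format, OF child_not_input[OF w] family_subset_an_sib[OF v(1) w]]
    have "AE \<omega> in omega N. vec_cond_exp (omega N) (sigma_obs N {w}) (grad w) \<omega> =
        vec_cond_exp (omega N) ?H (grad w) \<omega>"
      by simp
    with IH[OF w] show ?thesis
      by eventually_elim simp
  qed
  then have children: "AE \<omega> in omega N. \<forall>w\<in>ch N v.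
      vec_cond_exp (omega N) (sigma_obs N {w}) (syn_grad w) \<omega> = vec_cond_exp (omega N) ?H (grad w) \<omega>"
    by (simp add: AE_finite_all)
  have "AE \<omega> in omega N. vec_cond_exp (omega N) ?H (grad v) \<omega> =
      (\<Sum>w\<in>ch N v. jac v w (obs N w \<omega>) *v vec_cond_exp (omega N) ?H (grad w) \<omega>)"
    using grad_integrable[of v] unfolding grad_nonterminal[OF v(2)]
    by (intro H.vec_cond_exp_sum_mult grad_integrable jac_obs_measurable)
      (auto simp: child_not_input)
  with children show ?thesis
    unfolding syn_grad_nonterminal[OF v(2)] by eventually_elim simp
qed

text \<open>Induction from the terminal nodes downwards. The invariant concerns the conditional
  expectations, since these are what the recursion at the parents consumes; the synthetic gradient
  itself generally differs from \<open>grad\<close>.\<close>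

lemma cond_exp_syn_grad_eq:
  "\<not> input_node N v \<Longrightarrow> AE \<omega> in omega N.
    vec_cond_exp (omega N) (sigma_obs N {v}) (syn_grad v) \<omega> =
    vec_cond_exp (omega N) (sigma_obs N {v}) (grad v) \<omega>"
proof (induction v rule: grad.induct)
  case (1 v)
  show ?case
  proof (cases "terminal_node N v")
    case True
    then show ?thesis
      by (subst syn_grad.simps) simp
  next
    case False
    let ?H = "sigma_obs N (insert v (ch N v))"
    interpret F: finite_measure_subalgebra "omega N" "sigma_obs N {v}"
      by (rule finite_measure_subalgebra_sigma_obs)
    have "AE \<omega> in omega N. syn_grad v \<omega> = vec_cond_exp (omega N) ?H (grad v) \<omega>"
      using "1.IH" "1.prems" False child_not_input
      by (intro syn_grad_eq_cond_exp_grad_of_children) auto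
    then have "AE \<omega> in omega N. vec_cond_exp (omega N) (sigma_obs N {v}) (syn_grad v) \<omega> =
        vec_cond_exp (omega N) (sigma_obs N {v}) (vec_cond_exp (omega N) ?H (grad v)) \<omega>"
      by (intro F.vec_cond_exp_cong syn_grad_measurable borel_measurable_vec_cond_exp2)
    \<comment> \<open>Tower property: the observation of \<open>v\<close> is part of the family
      observed by \<open>?H\<close>.\<close>
    moreover have "AE \<omega> in omega N.
        vec_cond_exp (omega N) (sigma_obs N {v}) (vec_cond_exp (omega N) ?H (grad v)) \<omega> =
        vec_cond_exp (omega N) (sigma_obs N {v}) (grad v) \<omega>"
      by (intro F.vec_cond_exp_nested_subalg subalgebra_sigma_obs sigma_obs_mono grad_integrable) simp
    ultimately show ?thesis
      by eventually_elim simp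
  qed
qed

text \<open>The node \<open>v\<close> belongs to the conditioning family so that its parameter
  Jacobian, a function of its own observation, is measurable and can be moved under the conditional
  expectation.\<close>

lemma syn_grad_param_eq_cond_exp:
  assumes v: "\<not> input_node N v" "\<not> terminal_node N v"
  shows "AE \<omega> in omega N. syn_grad_param v \<omega> =
    vec_cond_exp (omega N) (sigma_obs N (insert v (ch N v))) (grad_param v) \<omega>"
proof -
  let ?H = "sigma_obs N (insert v (ch N v))"
  interpret H: finite_measure_subalgebra "omega N" ?H
    by (rule finite_measure_subalgebra_sigma_obs)
  have "AE \<omega> in omega N. syn_grad v \<omega> = vec_cond_exp (omega N) ?H (grad v) \<omega>"
    using v cond_exp_syn_grad_eq child_not_input
    by (intro syn_grad_eq_cond_exp_grad_of_children) auto
  moreover have "AE \<omega> in omega N. vec_cond_exp (omega N) ?H (grad_param v) \<omega> =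
      jac_param v (obs N v \<omega>) *v vec_cond_exp (omega N) ?H (grad v) \<omega>"
    \<comment> \<open>The singleton index set turns the rule for sums into the rule for one matrix
      factor.\<close>
    using H.vec_cond_exp_sum_mult[of "{v}" "\<lambda>v \<omega>. jac_param v (obs N v \<omega>)" grad]
      grad_param_integrable[OF v(1)] grad_integrable jac_param_obs_measurable[of v _, OF _ v(1)]
    by (simp add: grad_param_def[abs_def])
  ultimately show ?thesis
    by eventually_elim (simp add: syn_grad_param_def)
qed

section \<open>Comparison of the estimation errors\<close>

lemma err_eq:
  assumes "\<not> input_node N v" "n \<ge> 1"
  shows "err n v = ennreal (((\<integral>\<omega>. (norm (grad_param v \<omega>))\<^sup>2 \<partial>omega N) -
    (norm (\<integral>\<omega>. grad_param v \<omega> \<partial>omega N))\<^sup>2) / real n)"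
  unfolding err_def using assms
  by (intro prob_space.mean_sq_error_eq prob grad_param_measurable grad_param_square_integrable refl)

text \<open>Conditioning preserves the mean, so the synthetic estimator is unbiased for the true
  parameter gradient and its error is again a pure variance.\<close>

lemma syn_err_eq:
  assumes v: "\<not> input_node N v" "\<not> terminal_node N v" and n: "n \<ge> 1"
  defines "C \<equiv> vec_cond_exp (omega N) (sigma_obs N (insert v (ch N v))) (grad_param v)"
  shows "syn_err n v = ennreal (((\<integral>\<omega>. (norm (C \<omega>))\<^sup>2 \<partial>omega N) -
    (norm (\<integral>\<omega>. grad_param v \<omega> \<partial>omega N))\<^sup>2) / real n)"
proof -
  let ?H = "sigma_obs N (insert v (ch N v))"
  interpret H: finite_measure_subalgebra "omega N" ?H
    by (rule finite_measure_subalgebra_sigma_obs)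
  note [measurable] = syn_grad_param_measurable[OF v(1)] borel_measurable_vec_cond_exp2
  have C [measurable]: "C \<in> borel_measurable (omega N)"
    by (simp add: C_def)
  have eq: "AE \<omega> in omega N. syn_grad_param v \<omega> = C \<omega>"
    unfolding C_def by (rule syn_grad_param_eq_cond_exp[OF v])
  have C2: "integrable (omega N) (\<lambda>\<omega>. (norm (C \<omega>))\<^sup>2)"
    unfolding C_def
    by (rule H.vec_cond_exp_pythagoras[OF grad_param_measurable[OF v(1)] grad_param_square_integrable[OF v(1)]])
  have "integrable (omega N) (\<lambda>\<omega>. (norm (syn_grad_param v \<omega>))\<^sup>2)"
    using C2 by (rule integrable_cong_AE_imp) (use eq in auto)
  moreover have "(\<integral>\<omega>. (norm (syn_grad_param v \<omega>))\<^sup>2 \<partial>omega N) = (\<integral>\<omega>. (norm (C \<omega>))\<^sup>2 \<partial>omega N)"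
    by (rule integral_cong_AE) (use eq in auto)
  moreover have "(\<integral>\<omega>. syn_grad_param v \<omega> \<partial>omega N) = (\<integral>\<omega>. C \<omega> \<partial>omega N)"
    by (rule integral_cong_AE) (use eq in auto)
  moreover have "(\<integral>\<omega>. C \<omega> \<partial>omega N) = (\<integral>\<omega>. grad_param v \<omega> \<partial>omega N)"
    unfolding C_def by (rule H.integral_vec_cond_exp[OF grad_param_integrable[OF v(1)]])
  ultimately show ?thesis
    unfolding syn_err_def
    using prob_space.mean_sq_error_eq[OF prob syn_grad_param_measurable[OF v(1)] _ _ n] by metis
qed

text \<open>At terminal nodes the two estimators coincide. Elsewhere both have the same mean, and
  the Pythagorean identity shows that the synthetic second moment is not larger.\<close>

lemma syn_err_le_err:
  assumes v: "\<not> input_node N v" and n: "n \<ge> 1"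
  shows "syn_err n v \<le> err n v"
proof (cases "terminal_node N v")
  case True
  then have "syn_grad v = grad v"
    by (subst syn_grad.simps) simp
  then have "syn_grad_param v = grad_param v"
    by (simp add: syn_grad_param_def[abs_def] grad_param_def[abs_def])
  then show ?thesis
    by (simp add: syn_err_def err_def)
next
  case False
  interpret H: finite_measure_subalgebra "omega N" "sigma_obs N (insert v (ch N v))"
    by (rule finite_measure_subalgebra_sigma_obs)
  show ?thesis
    unfolding err_eq[OF v n] syn_err_eq[OF v False n]
    using H.vec_cond_exp_pythagoras(3)[OF grad_param_measurable[OF v] grad_param_square_integrable[OF v]]
    by (intro ennreal_leI divide_right_mono diff_right_mono) auto
qed

lemma syn_err_less_err:
  assumes v: "\<not> input_node N v" "\<not> terminal_node N v" and n: "n \<ge> 1"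
    and ne: "\<not> (AE \<omega> in omega N. grad_param v \<omega> =
      vec_cond_exp (omega N) (sigma_obs N (insert v (ch N v))) (grad_param v) \<omega>)"
  shows "syn_err n v < err n v"
proof -
  let ?H = "sigma_obs N (insert v (ch N v))"
  interpret H: finite_measure_subalgebra "omega N" ?H
    by (rule finite_measure_subalgebra_sigma_obs)
  define C where "C = vec_cond_exp (omega N) ?H (grad_param v)"
  note P = H.vec_cond_exp_pythagoras[OF grad_param_measurable[OF v(1)] grad_param_square_integrable[OF v(1)],
      folded C_def]
  \<comment> \<open>A nonnegative function has integral zero only if it vanishes almost surely,
    which \<open>ne\<close> excludes for the residual.\<close>
  have "(\<integral>\<omega>. (norm (grad_param v \<omega> - C \<omega>))\<^sup>2 \<partial>omega N) \<noteq> 0"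
    using ne integral_nonneg_eq_0_iff_AE[OF P(2)] by (simp add: C_def)
  then have "(\<integral>\<omega>. (norm (C \<omega>))\<^sup>2 \<partial>omega N) < (\<integral>\<omega>. (norm (grad_param v \<omega>))\<^sup>2 \<partial>omega N)"
    unfolding P(3) by (simp add: less_le)
  \<comment> \<open>The smaller variance must be nonnegative for \<open>ennreal\<close> to preserve
    the strict inequality.\<close>
  moreover have "(norm (\<integral>\<omega>. C \<omega> \<partial>omega N))\<^sup>2 \<le> (\<integral>\<omega>. (norm (C \<omega>))\<^sup>2 \<partial>omega N)"
    by (rule prob_space.norm_integral_power2_le[OF prob _ P(1)]) (simp add: C_def borel_measurable_vec_cond_exp2)
  ultimately show ?thesis
    unfolding err_eq[OF v(1) n] syn_err_eq[OF v n] C_def[symmetric]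
    using n H.integral_vec_cond_exp(2)[OF grad_param_integrable[OF v(1)], folded C_def]
    by (subst ennreal_less_iff) (auto simp: divide_strict_right_mono)
qed

lemma exists_syn_err_less_err:
  assumes n: "n \<ge> 1" and nondegenerate
  shows "\<exists>v. \<not> input_node N v \<and> syn_err n v < err n v"
proof -
  obtain v S where v: "\<not> input_node N v" "\<not> terminal_node N v"
    and S: "feedback_source S \<or> stochastic_source S \<or> sparsity_source v S"
    and pos: "measure (omega N) {\<omega> \<in> space (omega N).
       vec_cond_exp (omega N) (sigma_obs N (insert v (ch N v))) (grad_param v) \<omega> \<noteq>
       vec_cond_exp (omega N) (sigma_join (sigma_obs N (insert v (ch N v))) S) (grad_param v) \<omega>} > 0"
    using \<open>nondegenerate\<close> unfolding nondegenerate_def by blast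
  let ?H = "sigma_obs N (insert v (ch N v))"
  let ?K = "sigma_join ?H S"
  have K: "subalgebra (omega N) ?K" "subalgebra ?K ?H"
    using subalgebra_sigma_join[OF subalgebra_sigma_obs subalgebra_source[OF S]]
      sigma_join_subalgebra[OF subalgebra_sigma_obs subalgebra_source[OF S]] by auto
  interpret H: finite_measure_subalgebra "omega N" ?H
    by (rule finite_measure_subalgebra_sigma_obs)
  interpret K: finite_measure_subalgebra "omega N" ?K
    by (rule finite_measure_subalgebraI[OF prob K(1)])
  have "\<not> (AE \<omega> in omega N. grad_param v \<omega> = vec_cond_exp (omega N) ?H (grad_param v) \<omega>)"
  proof
    assume eq: "AE \<omega> in omega N. grad_param v \<omega> = vec_cond_exp (omega N) ?H (grad_param v) \<omega>"
    then have "AE \<omega> in omega N. vec_cond_exp (omega N) ?K (grad_param v) \<omega> =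
        vec_cond_exp (omega N) ?K (vec_cond_exp (omega N) ?H (grad_param v)) \<omega>"
      by (intro K.vec_cond_exp_cong grad_param_measurable[OF v(1)] borel_measurable_vec_cond_exp2)
    \<comment> \<open>A function measurable in \<open>?H\<close> is measurable in the finer
      \<open>?K\<close>, so conditioning on \<open>?K\<close> leaves it unchanged.\<close>
    moreover have "AE \<omega> in omega N. vec_cond_exp (omega N) ?K (vec_cond_exp (omega N) ?H (grad_param v)) \<omega> =
        vec_cond_exp (omega N) ?H (grad_param v) \<omega>"
      by (intro K.vec_cond_exp_F_meas H.integral_vec_cond_exp(1) grad_param_integrable[OF v(1)]
          measurable_from_subalg[OF K(2)] borel_measurable_vec_cond_exp)
    ultimately have "AE \<omega> in omega N. vec_cond_exp (omega N) ?H (grad_param v) \<omega> =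
        vec_cond_exp (omega N) ?K (grad_param v) \<omega>"
      by eventually_elim simp
    then have "measure (omega N) {\<omega> \<in> space (omega N).
       vec_cond_exp (omega N) ?H (grad_param v) \<omega> \<noteq> vec_cond_exp (omega N) ?K (grad_param v) \<omega>} = 0"
      by (intro measure_eq_0_null_sets) (simp add: AE_iff_null)
    with pos show False
      by simp
  qed
  from syn_err_less_err[OF v n this] v show ?thesis
    by blast
qed

end

end

theorem theorem2:
  fixes N :: "('v::finite, 'n::finite, 'p::finite, 'e, 'w) net"
    and n :: nat
  assumes "layered_net N"
    and "layered_net.finite_second_moments N"
    and "layered_net.condition_A N"
    and "layered_net.condition_B N"
    and "layered_net.nondegenerate N"
    and "n \<ge> 1"
  shows "(\<forall>v. \<not> input_node N v \<longrightarrow>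
            layered_net.syn_err N n v \<le> layered_net.err N n v) \<and>
         (\<exists>v. \<not> input_node N v \<and>
            layered_net.syn_err N n v < layered_net.err N n v)"
  using layered_net.syn_err_le_err[OF assms(1,2,4) _ assms(6)]
    layered_net.exists_syn_err_less_err[OF assms(1,2,4,6,5)]
  by blast

end
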